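(* Let $m,d\in\mathbb{N}$, let $\bm{r}=(r_1,\dots,r_m)^{\top}\in\mathbb{N}^m$ be a vector of positive integers with $r_1+\dots+r_m=d$, let $\alpha_j\le\beta_j$ be real numbers for $j=1,\dots,m$, let $\bm{x}_0\in\mathbb{R}^d$, and let $t\ge 0$. Let $\mathcal{R}(\{\bm{x}_0\},t)\subset\mathbb{R}^d$ be the forward reach set at time $t$ of the integrator dynamics with relative degree vector $\bm{r}$, initial condition $\bm{x}_0$ and input set $\mathcal{U}=[\alpha_1,\beta_1]\times\dots\times[\alpha_m,\beta_m]$ (see context). Then for every $\bm{y}=(\bm{y}_1,\dots,\bm{y}_m)\in\mathbb{R}^d$ with $\bm{y}_j\in\mathbb{R}^{r_j}$, the support function of $\mathcal{R}(\{\bm{x}_0\},t)$ is $$h_{\mathcal{R}(\{\bm{x}_0\},t)}(\bm{y})=\sum_{j=1}^{m}\left\{\big\langle \bm{y}_j,\ \exp(t\bm{A}_j)\bm{x}_{j0}+\nu_j\bm{\zeta}_j(t)\big\rangle+\mu_j\int_0^t\big|\langle \bm{y}_j,\bm{\xi}_j(s)\rangle\big|\,\mathrm{d}s\right\}.$$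
   Context: The integrator dynamics in Brunovsky normal form is $\dot{\bm{x}}=\bm{A}\bm{x}+\bm{B}\bm{u}$ with $\bm{x}\in\mathbb{R}^d$, $\bm{u}\in\mathbb{R}^m$, $\bm{A}=\mathrm{blkdiag}(\bm{A}_1,\dots,\bm{A}_m)$, $\bm{B}=\mathrm{blkdiag}(\bm{b}_1,\dots,\bm{b}_m)$ (block diagonal). Here $\bm{A}_j$ is the $r_j\times r_j$ matrix whose first column is zero and whose $(k+1)$-st column is the standard basis vector $\bm{e}_k\in\mathbb{R}^{r_j}$ for $k=1,\dots,r_j-1$ (ones on the superdiagonal, zeros elsewhere), and $\bm{b}_j=\bm{e}_{r_j}\in\mathbb{R}^{r_j}$ is the last standard basis vector. The forward reach set $\mathcal{R}(\{\bm{x}_0\},t)$ is the set of all states $\bm{x}(t)$ reachable at time $t$ from $\bm{x}(0)=\bm{x}_0$ using measurable inputs $\bm{u}:[0,t]\to\mathcal{U}$; equivalently $\mathcal{R}(\{\bm{x}_0\},t)=\exp(t\bm{A})\bm{x}_0+\int_0^t\exp(s\bm{A})\bm{B}\,\mathcal{U}\,\mathrm{d}s$, where the integral is the set-valued Aumann integral and the sum is a Minkowski sum. The vector $\bm{x}_0$ is partitioned as $\bm{x}_0=(\bm{x}_{10},\dots,\bm{x}_{m0})$ with $\bm{x}_{j0}\in\mathbb{R}^{r_j}$. Define $\mu_j=(\beta_j-\alpha_j)/2$, $\nu_j=(\beta_j+\alpha_j)/2$, $\bm{\xi}_j(s)=\left(\frac{s^{r_j-1}}{(r_j-1)!},\frac{s^{r_j-2}}{(r_j-2)!},\dots,s,1\right)^{\top}\in\mathbb{R}^{r_j}$,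 and $\bm{\zeta}_j(t)=\int_0^t\bm{\xi}_j(s)\,\mathrm{d}s\in\mathbb{R}^{r_j}$ (componentwise). The support function of a compact convex set $\mathcal{K}\subset\mathbb{R}^d$ is $h_{\mathcal{K}}(\bm{y})=\sup_{\bm{x}\in\mathcal{K}}\langle\bm{y},\bm{x}\rangle$, with $\langle\cdot,\cdot\rangle$ the Euclidean inner product. *)

theory Defs
  imports "HOL-Analysis.Analysis" "Jordan_Normal_Form.Jordan_Normal_Form"
begin

no_notation inner (infix "\<bullet>" 70)
no_notation Finite_Cartesian_Product.vec_nth (infixl "$" 90)
hide_type (open) Finite_Cartesian_Product.vec
hide_const (open) Finite_Cartesian_Product.vec

text \<open>
  Block and component indices start at 0. The matrix of the \<open>j\<close>-th chain of integrators (zero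
  first column, column \<open>k + 1\<close> equal to the \<open>k\<close>-th unit vector) is the nilpotent Jordan block
  \<^term>\<open>jordan_block n 0\<close>.
\<close>

definition brunovsky_A :: "nat \<Rightarrow> (nat \<Rightarrow> nat) \<Rightarrow> real mat" where
  "brunovsky_A m r = diag_block_mat (map (\<lambda>j. jordan_block (r j) 0) [0..<m])"

definition brunovsky_B :: "nat \<Rightarrow> (nat \<Rightarrow> nat) \<Rightarrow> real mat" where
  "brunovsky_B m r = diag_block_mat (map (\<lambda>j. mat_of_cols (r j) [unit_vec (r j) (r j - 1)]) [0..<m])"

definition input_box :: "nat \<Rightarrow> (nat \<Rightarrow> real) \<Rightarrow> (nat \<Rightarrow> real) \<Rightarrow> real vec set" where
  "input_box m \<alpha> \<beta> = {v \<in> carrier_vec m. \<forall>j<m. v $ j \<in> {\<alpha> j..\<beta> j}}"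

definition admissible_input :: "nat \<Rightarrow> real vec set \<Rightarrow> real \<Rightarrow> (real \<Rightarrow> real vec) \<Rightarrow> bool" where
  "admissible_input m U t u \<longleftrightarrow>
     (\<forall>s\<in>{0..t}. u s \<in> U) \<and>
     (\<forall>j<m. (\<lambda>s. u s $ j) \<in> borel_measurable (lebesgue_on {0..t}))"

text \<open>
  Since inputs are only measurable, \<open>x' = A x + B u\<close> is understood in the sense of
  Caratheodory: the state satisfies the integral equation, with a Lebesgue integral, in every
  component. This makes \<open>x\<close> absolutely continuous, with the differential equation holding
  almost everywhere.
\<close>

definition state_trajectory ::
  "real mat \<Rightarrow> real mat \<Rightarrow> real \<Rightarrow> (real \<Rightarrow> real vec) \<Rightarrow> (real \<Rightarrow> real vec) \<Rightarrow> bool" where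
  "state_trajectory A B t u x \<longleftrightarrow>
     (\<forall>s\<in>{0..t}. x s \<in> carrier_vec (dim_row A)) \<and>
     (\<forall>s\<in>{0..t}. \<forall>i<dim_row A.
        has_bochner_integral (lebesgue_on {0..s})
          (\<lambda>\<tau>. (A *\<^sub>v x \<tau> + B *\<^sub>v u \<tau>) $ i) (x s $ i - x 0 $ i))"

definition reach_set ::
  "real mat \<Rightarrow> real mat \<Rightarrow> real vec set \<Rightarrow> real vec set \<Rightarrow> real \<Rightarrow> real vec set" where
  "reach_set A B U X0 t =
     {x t |x u. admissible_input (dim_col B) U t u \<and> state_trajectory A B t u x \<and> x 0 \<in> X0}"

definition support_function :: "real vec set \<Rightarrow> real vec \<Rightarrow> real" where
  "support_function K y = (SUP x\<in>K. y \<bullet> x)"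

definition mat_exp :: "real mat \<Rightarrow> real mat" where
  "mat_exp A = mat (dim_row A) (dim_row A) (\<lambda>(i, j). \<Sum>k. (A ^\<^sub>m k) $$ (i, j) / fact k)"

definition block :: "(nat \<Rightarrow> nat) \<Rightarrow> nat \<Rightarrow> real vec \<Rightarrow> real vec" where
  "block r j x = vec (r j) (\<lambda>k. x $ ((\<Sum>i<j. r i) + k))"

definition xi :: "nat \<Rightarrow> real \<Rightarrow> real vec" where
  "xi n s = vec n (\<lambda>k. s ^ (n - 1 - k) / fact (n - 1 - k))"

definition zeta :: "nat \<Rightarrow> real \<Rightarrow> real vec" where
  "zeta n t = vec n (\<lambda>k. integral {0..t} (\<lambda>s. xi n s $ k))"

end

theory Submission
  imports Defs
begin

text \<open>
  The system splits into \<open>m\<close> decoupled chains of integrators, the \<open>j\<close>-th one driven only by the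
  input \<open>u\<^sub>j\<close>. Iterated integration of a chain, with Fubini's theorem in place of integration by
  parts because the input is merely measurable, gives
  \<open>\<langle>y\<^sub>j, x\<^sub>j(t)\<rangle> = \<langle>y\<^sub>j, exp(t A\<^sub>j) x\<^sub>j\<^sub>0\<rangle> + \<integral>\<^sub>0\<^sup>t \<phi>\<^sub>j(s) u\<^sub>j(s) ds\<close> with
  \<open>\<phi>\<^sub>j(s) = \<langle>y\<^sub>j, \<xi>\<^sub>j(t - s)\<rangle>\<close>. Over all inputs with values in \<open>[\<nu>\<^sub>j - \<mu>\<^sub>j, \<nu>\<^sub>j + \<mu>\<^sub>j]\<close> the integral is
  at most \<open>\<nu>\<^sub>j \<integral>\<phi>\<^sub>j + \<mu>\<^sub>j \<integral>\<bar>\<phi>\<^sub>j\<bar>\<close>, with equality for the bang-bang input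
  \<open>u\<^sub>j = \<nu>\<^sub>j + \<mu>\<^sub>j sgn \<phi>\<^sub>j\<close>. The substitution \<open>s \<mapsto> t - s\<close> turns this bound into the claimed formula.
\<close>

section \<open>Iterated integrals\<close>

text \<open>Fundamental theorem of calculus. Dividing powers by factorials means that each
  integration merely raises the index by one.\<close>

lemma has_bochner_integral_power_diff:
  fixes a b :: real
  assumes "a \<le> b"
  shows "has_bochner_integral lborel (\<lambda>x. (x - a) ^ p / fact p * indicator {a..b} x)
           ((b - a) ^ Suc p / fact (Suc p))"
proof -
  have "has_bochner_integral lborel (\<lambda>x. (x - a) ^ p / fact p * indicator {a..b} x)
          ((b - a) ^ Suc p / fact (Suc p) - (a - a) ^ Suc p / fact (Suc p))"
  proof (rule has_bochner_integral_FTC_Icc_real[OF assms])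
    fix x
    have "((\<lambda>x. (x - a) ^ Suc p / fact (Suc p)) has_real_derivative
             real (Suc p) * (x - a) ^ p / fact (Suc p)) (at x)"
      by (rule derivative_eq_intros refl | simp)+
    then show "((\<lambda>x. (x - a) ^ Suc p / fact (Suc p)) has_real_derivative (x - a) ^ p / fact p) (at x)"
      by (simp add: divide_simps del: power_Suc)
    show "isCont (\<lambda>x. (x - a) ^ p / fact p) x"
      by (intro continuous_intros) auto
  qed
  then show ?thesis by simp
qed

text \<open>Exchange the order of integration over the triangle 0 \<le> \<sigma> \<le> \<tau> \<le>
  s: for fixed \<sigma> the kernel integrates in \<tau> to the next normalised power. This is the
  inductive step of Cauchy's formula for repeated integration.\<close>

lemma lborel_Fubini_triangle:
  fixes v :: "real \<Rightarrow> real"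
  assumes v: "integrable lborel v" and "0 \<le> s"
  shows "(LINT \<tau>|lborel. indicator {0..s} \<tau> *
            (LINT \<sigma>|lborel. indicator {0..\<tau>} \<sigma> * ((\<tau> - \<sigma>) ^ p / fact p * v \<sigma>)))
       = (LINT \<sigma>|lborel. indicator {0..s} \<sigma> * ((s - \<sigma>) ^ Suc p / fact (Suc p) * v \<sigma>))"
proof -
  have [measurable]: "v \<in> borel_measurable borel"
    using v by auto
  \<comment> \<open>The kernel is extended by zero off the triangle, so that both iterated integrals
    run over the whole line; \<open>G\<close> is its integral in \<tau>.\<close>
  define g where "g \<sigma> \<tau> = (if 0 \<le> \<sigma> \<and> \<sigma> \<le> \<tau> \<and> \<tau> \<le> s then (\<tau> - \<sigma>) ^ p / fact p else 0)" for \<sigma> \<tau> :: real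
  define f where "f \<sigma> \<tau> = v \<sigma> * g \<sigma> \<tau>" for \<sigma> \<tau>
  define G where "G \<sigma> = indicator {0..s} \<sigma> * ((s - \<sigma>) ^ Suc p / fact (Suc p))" for \<sigma> :: real
  have g0: "0 \<le> g \<sigma> \<tau>" for \<sigma> \<tau>
    by (simp add: g_def)
  have g: "has_bochner_integral lborel (g \<sigma>) (G \<sigma>)" for \<sigma>
  proof (cases "\<sigma> \<in> {0..s}")
    case True
    then have "g \<sigma> = (\<lambda>x. (x - \<sigma>) ^ p / fact p * indicator {\<sigma>..s} x)"
      by (auto simp: g_def fun_eq_iff indicator_def)
    then show ?thesis
      using has_bochner_integral_power_diff[of \<sigma> s p] True by (simp add: G_def)
  next
    case False
    then have "g \<sigma> = (\<lambda>_. 0)" "G \<sigma> = 0"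
      by (auto simp: g_def G_def fun_eq_iff)
    then show ?thesis by (simp add: has_bochner_integral_zero)
  qed
  have [measurable]: "case_prod f \<in> borel_measurable (lborel \<Otimes>\<^sub>M lborel)" "G \<in> borel_measurable borel"
    unfolding f_def g_def G_def by measurable
  \<comment> \<open>A bound on \<open>G\<close> uniform in \<sigma> lets a constant multiple of the
    integrable \<open>v\<close> dominate the integrated norms, as Fubini's theorem demands.\<close>
  have GS: "\<bar>G \<sigma>\<bar> \<le> s ^ Suc p / fact (Suc p)" for \<sigma>
    using \<open>0 \<le> s\<close> by (auto simp: G_def indicator_def abs_mult intro!: divide_right_mono mult_mono power_mono simp del: fact_Suc)
  have ff: "has_bochner_integral lborel (f \<sigma>) (v \<sigma> * G \<sigma>)" for \<sigma>
    unfolding f_def by (intro has_bochner_integral_mult_right g)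
  \<comment> \<open>As \<open>g\<close> is nonnegative, taking norms only replaces \<open>v\<close>
    by its absolute value.\<close>
  have fn: "(LINT \<tau>|lborel. norm (f \<sigma> \<tau>)) = \<bar>v \<sigma>\<bar> * G \<sigma>" for \<sigma>
    using has_bochner_integral_mult_right[OF g, of "\<bar>v \<sigma>\<bar>" \<sigma>] g0
    by (simp add: f_def abs_mult has_bochner_integral_integral_eq[OF g])
  have "integrable (lborel \<Otimes>\<^sub>M lborel) (case_prod f)"
  proof (rule lborel_pair.Fubini_integrable)
    show "integrable lborel (\<lambda>\<sigma>. LINT \<tau>|lborel. norm (case_prod f (\<sigma>, \<tau>)))"
      unfolding prod.case fn
    proof (rule Bochner_Integration.integrable_bound)
      show "integrable lborel (\<lambda>\<sigma>. s ^ Suc p / fact (Suc p) * v \<sigma>)"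
        using v by simp
      show "AE \<sigma> in lborel. norm (\<bar>v \<sigma>\<bar> * G \<sigma>) \<le> norm (s ^ Suc p / fact (Suc p) * v \<sigma>)"
      proof (intro AE_I2)
        fix \<sigma>
        show "norm (\<bar>v \<sigma>\<bar> * G \<sigma>) \<le> norm (s ^ Suc p / fact (Suc p) * v \<sigma>)"
          using mult_left_mono[OF GS[of \<sigma>], of "\<bar>v \<sigma>\<bar>"] \<open>0 \<le> s\<close>
          by (simp add: abs_mult ac_simps)
      qed
    qed measurable
    show "AE \<sigma> in lborel. integrable lborel (\<lambda>\<tau>. case_prod f (\<sigma>, \<tau>))"
      using ff by (auto intro: integrable.intros)
  qed measurable
  from lborel_pair.Fubini_integral[OF this]
  have "(LINT \<tau>|lborel. LINT \<sigma>|lborel. f \<sigma> \<tau>) = (LINT \<sigma>|lborel. LINT \<tau>|lborel. f \<sigma> \<tau>)" .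
  also have "\<dots> = (LINT \<sigma>|lborel. v \<sigma> * G \<sigma>)"
    by (simp only: has_bochner_integral_integral_eq[OF ff])
  finally have *: "(LINT \<tau>|lborel. LINT \<sigma>|lborel. f \<sigma> \<tau>) = (LINT \<sigma>|lborel. v \<sigma> * G \<sigma>)" .
  \<comment> \<open>The two indicators together cut out the triangle. The reversed simp rule below
    moves the factor depending on \<tau> into the inner integral.\<close>
  have "f \<sigma> \<tau> = indicator {0..s} \<tau> * (indicator {0..\<tau>} \<sigma> * ((\<tau> - \<sigma>) ^ p / fact p * v \<sigma>))" for \<sigma> \<tau>
    by (auto simp: f_def g_def indicator_def)
  then have "(LINT \<tau>|lborel. LINT \<sigma>|lborel. f \<sigma> \<tau>) = (LINT \<tau>|lborel. indicator {0..s} \<tau> *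
            (LINT \<sigma>|lborel. indicator {0..\<tau>} \<sigma> * ((\<tau> - \<sigma>) ^ p / fact p * v \<sigma>)))"
    by (simp del: integral_mult_right_zero add: integral_mult_right_zero[symmetric])
  with * show ?thesis
    by (simp add: G_def ac_simps del: fact_Suc power_Suc)
qed

text \<open>The input is only Lebesgue measurable, so \<open>u\<close>, extended by zero off [0,s],
  is replaced by a Borel function \<open>v\<close> equal to it almost everywhere. Neither side
  changes, and the Borel version applies.\<close>

lemma lebesgue_on_Fubini_triangle:
  fixes u :: "real \<Rightarrow> real"
  assumes u: "integrable (lebesgue_on {0..s}) u" and "0 \<le> s"
  shows "(LINT \<tau>|lebesgue_on {0..s}. LINT \<sigma>|lebesgue_on {0..\<tau>}. (\<tau> - \<sigma>) ^ p / fact p * u \<sigma>)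
       = (LINT \<sigma>|lebesgue_on {0..s}. (s - \<sigma>) ^ Suc p / fact (Suc p) * u \<sigma>)"
proof -
  have ui: "integrable lebesgue (\<lambda>x. indicator {0..s} x * u x)"
    using u by (simp add: integrable_restrict_space)
  then obtain v where v: "v \<in> borel_measurable lborel"
      and "AE x in lborel. indicator {0..s} x * u x = v x"
    using completion_ex_borel_measurable_real[of "\<lambda>x. indicator {0..s} x * u x" lborel] by auto
  then have ae: "AE x in lebesgue. indicator {0..s} x * u x = v x"
    by (simp add: AE_completion)
  have vm[measurable]: "v \<in> borel_measurable borel" using v by simp
  have vi: "integrable lborel v"
  proof -
    have "integrable lebesgue v"
      using ui ae v by (subst integrable_cong_AE[symmetric]) (auto intro: measurable_completion)
    with v show ?thesis by (simp add: integrable_completion)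
  qed
  \<comment> \<open>Common to both sides: for a Borel weight \<open>w\<close>, passing from
    \<open>u\<close> to \<open>v\<close> also allows passing from the completed measure to
    \<open>lborel\<close>. The indicator of [0,s] can be inserted because \<tau> \<le> s.\<close>
  have inner: "(LINT \<sigma>|lebesgue_on {0..\<tau>}. w \<sigma> * u \<sigma>)
      = (LINT \<sigma>|lborel. indicator {0..\<tau>} \<sigma> * (w \<sigma> * v \<sigma>))"
    if "\<tau> \<in> {0..s}" and w[measurable]: "w \<in> borel_measurable borel" for \<tau> and w :: "real \<Rightarrow> real"
  proof -
    have "(LINT \<sigma>|lebesgue_on {0..\<tau>}. w \<sigma> * u \<sigma>) = (LINT \<sigma>|lebesgue. indicator {0..\<tau>} \<sigma> * (w \<sigma> * u \<sigma>))"
      by (simp add: integral_restrict_space)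
    also have "\<dots> = (LINT \<sigma>|lebesgue. indicator {0..\<tau>} \<sigma> * w \<sigma> * (indicator {0..s} \<sigma> * u \<sigma>))"
      using that by (intro Bochner_Integration.integral_cong) (auto simp: indicator_def)
    also have "\<dots> = (LINT \<sigma>|lebesgue. indicator {0..\<tau>} \<sigma> * w \<sigma> * v \<sigma>)"
    proof (rule integral_cong_AE)
      have wl: "(\<lambda>\<sigma>. indicator {0..\<tau>} \<sigma> * w \<sigma>) \<in> borel_measurable lebesgue"
        by (rule measurable_completion) measurable
      show "(\<lambda>\<sigma>. indicator {0..\<tau>} \<sigma> * w \<sigma> * (indicator {0..s} \<sigma> * u \<sigma>)) \<in> borel_measurable lebesgue"
        using ui by (intro borel_measurable_times[OF wl]) auto
      show "(\<lambda>\<sigma>. indicator {0..\<tau>} \<sigma> * w \<sigma> * v \<sigma>) \<in> borel_measurable lebesgue"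
        by (rule measurable_completion) measurable
      show "AE \<sigma> in lebesgue. indicator {0..\<tau>} \<sigma> * w \<sigma> * (indicator {0..s} \<sigma> * u \<sigma>)
          = indicator {0..\<tau>} \<sigma> * w \<sigma> * v \<sigma>"
        using ae by eventually_elim simp
    qed
    also have "\<dots> = (LINT \<sigma>|lborel. indicator {0..\<tau>} \<sigma> * w \<sigma> * v \<sigma>)"
      by (rule integral_completion) measurable
    finally show ?thesis by (simp add: mult.assoc)
  qed
  have "(LINT \<tau>|lebesgue_on {0..s}. LINT \<sigma>|lebesgue_on {0..\<tau>}. (\<tau> - \<sigma>) ^ p / fact p * u \<sigma>)
      = (LINT \<tau>|lebesgue_on {0..s}. LINT \<sigma>|lborel. indicator {0..\<tau>} \<sigma> * ((\<tau> - \<sigma>) ^ p / fact p * v \<sigma>))"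
    by (intro Bochner_Integration.integral_cong refl inner) auto
  also have "\<dots> = (LINT \<tau>|lebesgue. indicator {0..s} \<tau> *
      (LINT \<sigma>|lborel. indicator {0..\<tau>} \<sigma> * ((\<tau> - \<sigma>) ^ p / fact p * v \<sigma>)))"
    by (simp add: integral_restrict_space)
  also have "\<dots> = (LINT \<tau>|lborel. indicator {0..s} \<tau> *
      (LINT \<sigma>|lborel. indicator {0..\<tau>} \<sigma> * ((\<tau> - \<sigma>) ^ p / fact p * v \<sigma>)))"
  proof (rule integral_completion)
    \<comment> \<open>Leaving the completion requires Borel measurability in \<tau>. Written as a
      condition on \<sigma> and \<tau>, the indicator with moving endpoint is visibly jointly
      measurable.\<close>
    have "indicator {0..\<tau>} \<sigma> = (if 0 \<le> \<sigma> \<and> \<sigma> \<le> \<tau> then 1 else 0 :: real)" for \<sigma> \<tau> :: real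
      by (simp add: indicator_def)
    then show "(\<lambda>\<tau>. indicator {0..s} \<tau> *
        (LINT \<sigma>|lborel. indicator {0..\<tau>} \<sigma> * ((\<tau> - \<sigma>) ^ p / fact p * v \<sigma>))) \<in> lborel \<rightarrow>\<^sub>M borel"
      by simp
  qed
  also have "\<dots> = (LINT \<sigma>|lborel. indicator {0..s} \<sigma> * ((s - \<sigma>) ^ Suc p / fact (Suc p) * v \<sigma>))"
    by (rule lborel_Fubini_triangle[OF vi \<open>0 \<le> s\<close>])
  also have "\<dots> = (LINT \<sigma>|lebesgue_on {0..s}. (s - \<sigma>) ^ Suc p / fact (Suc p) * u \<sigma>)"
    using \<open>0 \<le> s\<close> by (intro inner[symmetric]) auto
  finally show ?thesis .
qed

section \<open>Chains of integrators\<close>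

text \<open>Integral form of x_k' = x_{k+1}, closed by the input at the last index. The component
  index comes before time so that a component is itself a function to integrate.\<close>

definition integrator_chain :: "nat \<Rightarrow> real \<Rightarrow> (real \<Rightarrow> real) \<Rightarrow> (nat \<Rightarrow> real \<Rightarrow> real) \<Rightarrow> bool" where
  "integrator_chain n t u x \<longleftrightarrow>
     (\<forall>s\<in>{0..t}. \<forall>k<n. has_bochner_integral (lebesgue_on {0..s})
        (if Suc k < n then x (Suc k) else u) (x k s - x k 0))"

lemma integrator_chain_cong:
  assumes "\<And>k. k < n \<Longrightarrow> x k = x' k"
  shows "integrator_chain n t u x \<longleftrightarrow> integrator_chain n t u x'"
  unfolding integrator_chain_def by (intro ball_cong all_cong refl) (simp add: assms)

lemma has_bochner_integral_lebesgue_on_power: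
  fixes s :: real
  assumes "0 \<le> s"
  shows "has_bochner_integral (lebesgue_on {0..s}) (\<lambda>\<tau>. \<tau> ^ i / fact i * c) (s ^ Suc i / fact (Suc i) * c)"
proof -
  have "has_bochner_integral lborel (\<lambda>x. x ^ i / fact i * indicator {0..s} x) (s ^ Suc i / fact (Suc i))"
    using has_bochner_integral_power_diff[OF assms, of i] by simp
  then have "has_bochner_integral lebesgue (\<lambda>x. x ^ i / fact i * indicator {0..s} x) (s ^ Suc i / fact (Suc i))"
    unfolding has_bochner_integral_iff by (subst integrable_completion integral_completion; simp)+
  then have "has_bochner_integral (lebesgue_on {0..s}) (\<lambda>x. x ^ i / fact i) (s ^ Suc i / fact (Suc i))"
    by (simp add: has_bochner_integral_restrict_space mult.commute)
  then show ?thesis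
    by (rule has_bochner_integral_mult_left)
qed

text \<open>Here \<open>p\<close> counts the distance from the last component, the one driven
  directly by the input. Each induction step integrates the formula of the following component: the
  Taylor terms of the initial values rise by one degree, and the double integral of the input
  collapses by the triangle formula.\<close>

lemma integrator_chain_solution:
  assumes chain: "integrator_chain n t u x" and "p < n" "s \<in> {0..t}"
  shows "x (n - 1 - p) s = (\<Sum>i\<le>p. s ^ i / fact i * x (n - 1 - p + i) 0)
           + (LINT \<sigma>|lebesgue_on {0..s}. (s - \<sigma>) ^ p / fact p * u \<sigma>)"
  using assms(2,3)
proof (induction p arbitrary: s)
  case 0
  then have "has_bochner_integral (lebesgue_on {0..s}) u (x (n - 1) s - x (n - 1) 0)"
    using chain[unfolded integrator_chain_def, rule_format, of s "n - 1"] by simp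
  then show ?case
    by (simp add: has_bochner_integral_integral_eq)
next
  case (Suc p)
  define k where "k = n - 1 - Suc p"
  have k: "n - 1 - p = Suc k" "Suc k < n"
    using Suc.prems by (auto simp: k_def)
  let ?L = "lebesgue_on {0..s}"
  \<comment> \<open>The polynomial part is split off because it can be integrated explicitly; what
    remains is exactly the double integral.\<close>
  define P where "P \<tau> = (\<Sum>i\<le>p. \<tau> ^ i / fact i * x (Suc k + i) 0)" for \<tau>
  have hx: "has_bochner_integral ?L (x (Suc k)) (x k s - x k 0)"
    using chain[unfolded integrator_chain_def, rule_format, of s k] k Suc.prems by simp
  have hP: "has_bochner_integral ?L P (\<Sum>i\<le>p. s ^ Suc i / fact (Suc i) * x (Suc k + i) 0)"
    unfolding P_def using Suc.prems
    by (intro has_bochner_integral_sum has_bochner_integral_lebesgue_on_power) auto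
  \<comment> \<open>Integrability of the input is contained in the last equation of the
    chain.\<close>
  have u: "integrable ?L u"
    using chain[unfolded integrator_chain_def, rule_format, of s "n - 1"] Suc.prems
    by (auto simp: has_bochner_integral_iff)
  have IH: "x (Suc k) \<tau> = P \<tau> + (LINT \<sigma>|lebesgue_on {0..\<tau>}. (\<tau> - \<sigma>) ^ p / fact p * u \<sigma>)"
    if "\<tau> \<in> {0..s}" for \<tau>
    using Suc.IH[of \<tau>] that Suc.prems unfolding k(1) P_def by simp
  have "x k s - x k 0 - (\<Sum>i\<le>p. s ^ Suc i / fact (Suc i) * x (Suc k + i) 0)
      = (LINT \<tau>|?L. x (Suc k) \<tau> - P \<tau>)"
    using has_bochner_integral_diff[OF hx hP] by (simp add: has_bochner_integral_integral_eq)
  also have "\<dots> = (LINT \<tau>|?L. LINT \<sigma>|lebesgue_on {0..\<tau>}. (\<tau> - \<sigma>) ^ p / fact p * u \<sigma>)"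
    by (intro Bochner_Integration.integral_cong) (auto simp: IH)
  also have "\<dots> = (LINT \<sigma>|?L. (s - \<sigma>) ^ Suc p / fact (Suc p) * u \<sigma>)"
    using Suc.prems by (intro lebesgue_on_Fubini_triangle u) auto
  finally have "x k s = (x k 0 + (\<Sum>i\<le>p. s ^ Suc i / fact (Suc i) * x (Suc k + i) 0))
      + (LINT \<sigma>|?L. (s - \<sigma>) ^ Suc p / fact (Suc p) * u \<sigma>)"
    by linarith
  then show ?case
    unfolding k_def[symmetric] sum.atMost_Suc_shift by simp
qed

text \<open>Solve from the input end: every component is an initial value plus the integral of the
  one already built. Indefinite integrals are continuous, hence integrable again, so the recursion
  never stops.\<close>

lemma integrator_chain_exists:
  assumes u: "integrable (lebesgue_on {0..t}) u"
  shows "\<exists>x. integrator_chain n t u x \<and> (\<forall>k<n. x k 0 = a k)"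
proof -
  \<comment> \<open>Indices run backwards: \<open>z p\<close> is component
    \<open>n - 1 - p\<close>.\<close>
  define z where "z = rec_nat (\<lambda>s. a (n - 1) + (LINT \<sigma>|lebesgue_on {0..s}. u \<sigma>))
    (\<lambda>p w s. a (n - 1 - Suc p) + (LINT \<sigma>|lebesgue_on {0..s}. w \<sigma>))"
  have z0: "z 0 s = a (n - 1) + (LINT \<sigma>|lebesgue_on {0..s}. u \<sigma>)"
    and zS: "z (Suc p) s = a (n - 1 - Suc p) + (LINT \<sigma>|lebesgue_on {0..s}. z p \<sigma>)" for p s
    by (simp_all add: z_def)
  \<comment> \<open>A singleton is a null set, so at time 0 the integrals vanish and the prescribed
    initial values remain.\<close>
  have "AE x in lebesgue_on {0::real}. False"
    using AE_completion[OF AE_lborel_singleton[of "0::real"]] by (simp add: AE_restrict_space_iff)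
  then have "(LINT \<sigma>|lebesgue_on {0}. w \<sigma>) = 0" for w :: "real \<Rightarrow> real"
    by (intro integral_eq_zero_AE) (auto elim: eventually_mono)
  then have z_init: "z p 0 = a (n - 1 - p)" for p
    by (cases p) (simp_all add: z0 zS)
  have z_cont: "continuous_on {0..t} (z p)" for p
  proof (induction p)
    case 0
    show ?case
      unfolding z0 by (intro continuous_intros indefinite_integral_continuous_real u)
  next
    case (Suc p)
    show ?case
      unfolding zS
      by (intro continuous_intros indefinite_integral_continuous_real continuous_imp_integrable_real Suc)
  qed
  have "integrator_chain n t u (\<lambda>k. z (n - 1 - k))"
    unfolding integrator_chain_def
  proof (intro ballI allI impI)
    fix s k assume s: "s \<in> {0..t}" and k: "k < n"
    show "has_bochner_integral (lebesgue_on {0..s}) (if Suc k < n then z (n - 1 - Suc k) else u)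
            (z (n - 1 - k) s - z (n - 1 - k) 0)"
    proof (cases "Suc k < n")
      case True
      then have *: "n - 1 - k = Suc (n - 1 - Suc k)" by simp
      have "integrable (lebesgue_on {0..s}) (z (n - 1 - Suc k))"
        by (rule Equivalence_Lebesgue_Henstock_Integration.integrable_subinterval[OF continuous_imp_integrable_real[OF z_cont]])
          (use s in auto)
      then show ?thesis
        using True unfolding * z_init by (simp add: zS has_bochner_integral_iff)
    next
      case False
      then have *: "n - 1 - k = 0" using k by simp
      have "integrable (lebesgue_on {0..s}) u"
        by (rule Equivalence_Lebesgue_Henstock_Integration.integrable_subinterval[OF u]) (use s in auto)
      then show ?thesis
        using False unfolding * z_init by (simp add: z0 has_bochner_integral_iff)
    qed
  qed
  then show ?thesis
    by (intro exI[of _ "\<lambda>k. z (n - 1 - k)"]) (auto simp: z_init)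
qed

section \<open>Optimal scalar controls\<close>

text \<open>A value in [\<alpha>,\<beta>] has modulus at most max(|\<alpha>|,|\<beta>|), so a
  multiple of the integrable \<phi> dominates the product.\<close>

lemma integrable_bounded_mult_continuous:
  fixes \<phi> u :: "real \<Rightarrow> real"
  assumes \<phi>: "continuous_on {0..t} \<phi>" and u: "u \<in> borel_measurable (lebesgue_on {0..t})"
    and b: "\<And>s. s \<in> {0..t} \<Longrightarrow> u s \<in> {\<alpha>..\<beta>}"
  shows "integrable (lebesgue_on {0..t}) (\<lambda>s. \<phi> s * u s)"
proof (rule Bochner_Integration.integrable_bound)
  have int: "integrable (lebesgue_on {0..t}) \<phi>"
    by (rule continuous_imp_integrable_real[OF \<phi>])
  then show "integrable (lebesgue_on {0..t}) (\<lambda>s. \<phi> s * max \<bar>\<alpha>\<bar> \<bar>\<beta>\<bar>)"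
    by simp
  show "(\<lambda>s. \<phi> s * u s) \<in> borel_measurable (lebesgue_on {0..t})"
    using int u by (intro borel_measurable_times) auto
  show "AE s in lebesgue_on {0..t}. norm (\<phi> s * u s) \<le> norm (\<phi> s * max \<bar>\<alpha>\<bar> \<bar>\<beta>\<bar>)"
  proof (rule AE_I2)
    fix s assume "s \<in> space (lebesgue_on {0..t})"
    then have "u s \<in> {\<alpha>..\<beta>}" using b by simp
    then have "\<bar>u s\<bar> \<le> max \<bar>\<alpha>\<bar> \<bar>\<beta>\<bar>" by auto
    then show "norm (\<phi> s * u s) \<le> norm (\<phi> s * max \<bar>\<alpha>\<bar> \<bar>\<beta>\<bar>)"
      by (auto simp: abs_mult intro!: mult_left_mono)
  qed
qed

text \<open>Write \<nu> for the midpoint and \<mu> for half the length of the interval. Pointwise,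
  |u - \<nu>| \<le> \<mu> gives \<phi> u \<le> \<nu> \<phi> + \<mu> |\<phi>|, and \<phi> sgn \<phi>
  = |\<phi>| turns this into an equality for the bang-bang control.\<close>

lemma
  fixes \<phi> :: "real \<Rightarrow> real" and \<alpha> \<beta> :: real
  assumes \<phi>: "continuous_on {0..t} \<phi>"
  defines "V \<equiv> (\<beta> + \<alpha>) / 2 * integral {0..t} \<phi> + (\<beta> - \<alpha>) / 2 * integral {0..t} (\<lambda>s. \<bar>\<phi> s\<bar>)"
  shows box_control_integral_le:
      "\<lbrakk>u \<in> borel_measurable (lebesgue_on {0..t}); \<And>s. s \<in> {0..t} \<Longrightarrow> u s \<in> {\<alpha>..\<beta>}\<rbrakk>
        \<Longrightarrow> (LINT s|lebesgue_on {0..t}. \<phi> s * u s) \<le> V"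
    and bang_bang_integral_eq:
      "(LINT s|lebesgue_on {0..t}. \<phi> s * ((\<beta> + \<alpha>) / 2 + (\<beta> - \<alpha>) / 2 * sgn (\<phi> s))) = V"
proof -
  let ?L = "lebesgue_on {0..t}"
  have 1: "integrable ?L \<phi>" "integrable ?L (\<lambda>s. \<bar>\<phi> s\<bar>)"
    by (intro continuous_imp_integrable_real continuous_intros \<phi>)+
  have V: "has_bochner_integral ?L (\<lambda>s. (\<beta> + \<alpha>) / 2 * \<phi> s + (\<beta> - \<alpha>) / 2 * \<bar>\<phi> s\<bar>) V"
    using 1 by (auto simp: V_def has_bochner_integral_iff lebesgue_integral_eq_integral)
  have "(LINT s|?L. \<phi> s * ((\<beta> + \<alpha>) / 2 + (\<beta> - \<alpha>) / 2 * sgn (\<phi> s)))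
      = (LINT s|?L. (\<beta> + \<alpha>) / 2 * \<phi> s + (\<beta> - \<alpha>) / 2 * \<bar>\<phi> s\<bar>)"
    by (intro Bochner_Integration.integral_cong) (auto simp: abs_sgn algebra_simps)
  then show "(LINT s|?L. \<phi> s * ((\<beta> + \<alpha>) / 2 + (\<beta> - \<alpha>) / 2 * sgn (\<phi> s))) = V"
    using V by (simp add: has_bochner_integral_iff)
  assume u: "u \<in> borel_measurable ?L" and b: "\<And>s. s \<in> {0..t} \<Longrightarrow> u s \<in> {\<alpha>..\<beta>}"
  have "(LINT s|?L. \<phi> s * u s) \<le> (LINT s|?L. (\<beta> + \<alpha>) / 2 * \<phi> s + (\<beta> - \<alpha>) / 2 * \<bar>\<phi> s\<bar>)"
  proof (rule integral_mono)
    show "integrable ?L (\<lambda>s. \<phi> s * u s)"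
      by (rule integrable_bounded_mult_continuous[OF \<phi> u b])
    show "integrable ?L (\<lambda>s. (\<beta> + \<alpha>) / 2 * \<phi> s + (\<beta> - \<alpha>) / 2 * \<bar>\<phi> s\<bar>)"
      using V by (simp add: has_bochner_integral_iff)
    fix s assume "s \<in> space ?L"
    then have "u s \<in> {\<alpha>..\<beta>}" using b by simp
    then have "\<bar>u s - (\<beta> + \<alpha>) / 2\<bar> \<le> (\<beta> - \<alpha>) / 2"
      unfolding abs_le_iff by (simp add: field_simps)
    then have "\<bar>\<phi> s\<bar> * \<bar>u s - (\<beta> + \<alpha>) / 2\<bar> \<le> \<bar>\<phi> s\<bar> * ((\<beta> - \<alpha>) / 2)"
      by (intro mult_left_mono) auto
    then have "\<phi> s * (u s - (\<beta> + \<alpha>) / 2) \<le> \<bar>\<phi> s\<bar> * ((\<beta> - \<alpha>) / 2)"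
      by (metis abs_ge_self abs_mult order_trans)
    moreover have "\<phi> s * (u s - (\<beta> + \<alpha>) / 2) = \<phi> s * u s - (\<beta> + \<alpha>) / 2 * \<phi> s"
      by (simp add: right_diff_distrib)
    ultimately show "\<phi> s * u s \<le> (\<beta> + \<alpha>) / 2 * \<phi> s + (\<beta> - \<alpha>) / 2 * \<bar>\<phi> s\<bar>"
      by (simp only: mult.commute)
  qed
  then show "(LINT s|?L. \<phi> s * u s) \<le> V"
    using V by (simp add: has_bochner_integral_iff)
qed

text \<open>Reflection at 0 followed by a shift by \<open>t\<close>; this later removes the time
  reversal from the convolution kernel.\<close>

lemma integral_reflect_about_midpoint:
  fixes g :: "real \<Rightarrow> real"
  shows "integral {0..t} (\<lambda>s. g (t - s)) = integral {0..t} g"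
proof -
  have "integral {0..t} (\<lambda>s. g (t - s)) = integral {-t..-0} (g \<circ> (+) t)"
    using Henstock_Kurzweil_Integration.integral_reflect_real[of t 0 "\<lambda>s. g (t - s)"]
    by (simp add: o_def)
  also have "\<dots> = integral {0..t} g"
    by (simp only: integral_shift_Icc_real) simp
  finally show ?thesis .
qed

section \<open>Block structure\<close>

lemma block_index_less:
  fixes r :: "nat \<Rightarrow> nat"
  assumes "j < m" "k < r j"
  shows "(\<Sum>i<j. r i) + k < (\<Sum>i<m. r i)"
proof -
  have "(\<Sum>i<j. r i) + k < (\<Sum>i<Suc j. r i)"
    using assms by simp
  also have "\<dots> \<le> (\<Sum>i<m. r i)"
    using assms by (intro sum_mono2) auto
  finally show ?thesis .
qed

text \<open>Surjectivity of the indexing by block and offset, which turns statements about all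
  components into statements about all blocks.\<close>

lemma block_index_cases:
  fixes r :: "nat \<Rightarrow> nat"
  assumes "i < (\<Sum>j<m. r j)"
  obtains j k where "j < m" "k < r j" "i = (\<Sum>i<j. r i) + k"
proof -
  have "\<exists>j<m. \<exists>k<r j. i = (\<Sum>i<j. r i) + k"
    using assms
  proof (induction m)
    case (Suc m)
    show ?case
    proof (cases "i < (\<Sum>j<m. r j)")
      case True
      with Suc.IH show ?thesis using less_SucI by blast
    next
      case False
      with Suc.prems show ?thesis
        by (intro exI[of _ m] exI[of _ "i - (\<Sum>j<m. r j)"] conjI) auto
    qed
  qed simp
  then show thesis using that by blast
qed

lemma dim_block [simp]: "dim_vec (block r j x) = r j"
  by (simp add: block_def)

lemma index_block [simp]: "k < r j \<Longrightarrow> block r j x $ k = x $ ((\<Sum>i<j. r i) + k)"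
  by (simp add: block_def)

lemma scalar_prod_blocks:
  assumes "x \<in> carrier_vec (\<Sum>j<m. r j)"
  shows "y \<bullet> x = (\<Sum>j<m. block r j y \<bullet> block r j x)"
proof -
  have "(\<Sum>i\<in>{0..<(\<Sum>j<m. r j)}. y $ i * x $ i)
      = (\<Sum>j<m. \<Sum>k\<in>{0..<r j}. y $ ((\<Sum>i<j. r i) + k) * x $ ((\<Sum>i<j. r i) + k))"
  proof (induction m)
    case (Suc m)
    let ?o = "\<Sum>j<m. r j"
    have "(\<Sum>i\<in>{0..<?o + r m}. y $ i * x $ i)
        = (\<Sum>i\<in>{0..<?o}. y $ i * x $ i) + (\<Sum>i\<in>{?o..<?o + r m}. y $ i * x $ i)"
      by (simp add: sum.atLeastLessThan_concat)
    also have "(\<Sum>i\<in>{?o..<?o + r m}. y $ i * x $ i) = (\<Sum>k\<in>{0..<r m}. y $ (?o + k) * x $ (?o + k))"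
      using sum.shift_bounds_nat_ivl[of "\<lambda>i. y $ i * x $ i" 0 ?o "r m"] by (simp add: add.commute)
    finally show ?case by (simp add: Suc)
  qed simp
  then show ?thesis
    using assms by (simp add: scalar_prod_def)
qed

lemma block_append_left:
  assumes "x \<in> carrier_vec (\<Sum>j<m. r j)" "j < m"
  shows "block r j (x @\<^sub>v w) = block r j x"
proof (intro eq_vecI)
  fix k assume "k < dim_vec (block r j x)"
  then have "(\<Sum>i<j. r i) + k < dim_vec x"
    using assms block_index_less[of j m k r] by simp
  with \<open>k < dim_vec (block r j x)\<close> show "block r j (x @\<^sub>v w) $ k = block r j x $ k"
    by (simp add: trans_less_add1)
qed simp

lemma block_append_right:
  assumes "x \<in> carrier_vec (\<Sum>j<m. r j)" "w \<in> carrier_vec (r m)"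
  shows "block r m (x @\<^sub>v w) = w"
  using assms by (intro eq_vecI) auto

text \<open>Append the blocks one by one. It serves to assemble a state from separately solved
  chains.\<close>

lemma vec_of_blocks_exists:
  "\<exists>x \<in> carrier_vec (\<Sum>j<m. r j). \<forall>j<m. block r j x = vec (r j) (F j)"
proof (induction m)
  case 0
  show ?case by (intro bexI[of _ "0\<^sub>v 0"]) auto
next
  case (Suc m)
  then obtain x where x: "x \<in> carrier_vec (\<Sum>j<m. r j)" "\<And>j. j < m \<Longrightarrow> block r j x = vec (r j) (F j)"
    by blast
  let ?x = "x @\<^sub>v vec (r m) (F m)"
  have "block r j ?x = vec (r j) (F j)" if "j < Suc m" for j
  proof (cases "j < m")
    case True
    then show ?thesis using block_append_left[OF x(1)] x(2) by simp
  next
    case False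
    then have "j = m" using that by simp
    then show ?thesis using block_append_right[OF x(1)] by simp
  qed
  moreover have "?x \<in> carrier_vec (\<Sum>j<Suc m. r j)"
    using x(1) by auto
  ultimately show ?case by blast
qed

lemma eq_vec_blocksI:
  assumes "x \<in> carrier_vec (\<Sum>j<m. r j)" "y \<in> carrier_vec (\<Sum>j<m. r j)"
    and "\<And>j. j < m \<Longrightarrow> block r j x = block r j y"
  shows "x = y"
proof (intro eq_vecI)
  fix i assume "i < dim_vec y"
  then have "i < (\<Sum>j<m. r j)" using assms by simp
  then obtain j k where "j < m" "k < r j" "i = (\<Sum>i<j. r i) + k"
    by (rule block_index_cases)
  then show "x $ i = y $ i"
    using assms(3) index_block by metis
qed (use assms in auto)

lemma append_vec_split:
  assumes "v \<in> carrier_vec (a + b)"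
  shows "v = vec a (\<lambda>i. v $ i) @\<^sub>v vec b (\<lambda>i. v $ (a + i))"
  using assms by (intro eq_vecI) auto

section \<open>Action of block diagonal matrices\<close>

text \<open>Induction that peels off the last block: the larger matrix is a two-by-two block matrix
  with zero off-diagonal blocks. Row and column sizes are separate families because the blocks of B
  are single columns.\<close>

lemma diag_block_mat_mult_vec:
  assumes "\<And>j. j < m \<Longrightarrow> M j \<in> carrier_mat (r j) (c j)"
    and "x \<in> carrier_vec (\<Sum>j<m. c j)" and "j < m"
  shows "block r j (diag_block_mat (map M [0..<m]) *\<^sub>v x) = M j *\<^sub>v block c j x"
  using assms
proof (induction m arbitrary: x)
  case (Suc m)
  let ?D = "diag_block_mat (map M [0..<m])"
  let ?a = "vec (\<Sum>j<m. c j) (\<lambda>i. x $ i)" and ?b = "block c m x"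
  have D: "?D \<in> carrier_mat (\<Sum>j<m. r j) (\<Sum>j<m. c j)"
  proof (intro carrier_matI)
    have "dim_row (M j) = r j" "dim_col (M j) = c j" if "j < m" for j
      using Suc.prems(1)[of j] that by auto
    then have "map (dim_row \<circ> M) [0..<m] = map r [0..<m]" "map (dim_col \<circ> M) [0..<m] = map c [0..<m]"
      by auto
    then show "dim_row ?D = (\<Sum>j<m. r j)" "dim_col ?D = (\<Sum>j<m. c j)"
      by (simp_all add: dim_diag_block_mat interv_sum_list_conv_sum_set_nat atLeast0LessThan)
  qed
  have M: "M m \<in> carrier_mat (r m) (c m)"
    using Suc.prems(1) by simp
  have x: "x = ?a @\<^sub>v ?b"
    using append_vec_split[of x "\<Sum>j<m. c j" "c m"] Suc.prems(2) by (simp add: block_def)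
  have "diag_block_mat (map M [0..<Suc m]) =
      four_block_mat ?D (0\<^sub>m (\<Sum>j<m. r j) (c m)) (0\<^sub>m (r m) (\<Sum>j<m. c j)) (M m)"
    using D M by (simp add: diag_block_mat_last Let_def)
  moreover have "four_block_mat ?D (0\<^sub>m (\<Sum>j<m. r j) (c m)) (0\<^sub>m (r m) (\<Sum>j<m. c j)) (M m) *\<^sub>v (?a @\<^sub>v ?b)
      = (?D *\<^sub>v ?a) @\<^sub>v (M m *\<^sub>v ?b)"
    by (subst four_block_mat_mult_vec[OF D _ _ M]) (use D M in \<open>auto simp: block_def\<close>)
  ultimately have *: "diag_block_mat (map M [0..<Suc m]) *\<^sub>v x = (?D *\<^sub>v ?a) @\<^sub>v (M m *\<^sub>v ?b)"
    using x by simp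
  show ?case
  proof (cases "j < m")
    case True
    have "block r j ((?D *\<^sub>v ?a) @\<^sub>v (M m *\<^sub>v ?b)) = block r j (?D *\<^sub>v ?a)"
      using D by (intro block_append_left[OF _ True]) auto
    also have "\<dots> = M j *\<^sub>v block c j ?a"
      using Suc.prems(1) True by (intro Suc.IH) auto
    also have "block c j ?a = block c j x"
      \<comment> \<open>The first occurrence of \<open>x\<close> lies inside the truncated vector;
        only the second one is to be split.\<close>
      by (subst (2) x) (rule block_append_left[symmetric], use True in auto)
    finally show ?thesis unfolding * .
  next
    case False
    then have [simp]: "j = m" using Suc.prems by simp
    show ?thesis
      unfolding * using D M by (simp, intro block_append_right carrier_vecI) auto
  qed
qed simp

section \<open>The nilpotent block and its exponential\<close>

lemma jordan_block_0_mult_vec: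
  assumes "v \<in> carrier_vec n" "k < n"
  shows "(jordan_block n 0 *\<^sub>v v) $ k = (if Suc k < n then v $ Suc k else (0::real))"
proof -
  have "(jordan_block n 0 *\<^sub>v v) $ k = (\<Sum>l\<in>{0..<n}. jordan_block n 0 $$ (k, l) * v $ l)"
    using assms by (simp add: scalar_prod_def)
  also have "\<dots> = (\<Sum>l\<in>{0..<n}. (if l = Suc k then v $ l else 0))"
    using assms by (intro sum.cong) auto
  finally show ?thesis by simp
qed

lemma unit_column_mult_vec:
  assumes "v \<in> carrier_vec 1" "k < n"
  shows "(mat_of_cols n [unit_vec n (n - 1)] *\<^sub>v v) $ k = (if Suc k < n then 0 else v $ 0 :: real)"
  using assms by (auto simp: scalar_prod_def mat_of_cols_def)

lemma smult_pow_mat: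
  assumes "A \<in> carrier_mat n n"
  shows "(c \<cdot>\<^sub>m A) ^\<^sub>m k = (c ^ k :: 'a :: comm_ring_1) \<cdot>\<^sub>m (A ^\<^sub>m k)"
proof (induction k)
  case 0
  show ?case by auto
next
  case (Suc k)
  have "A ^\<^sub>m k \<in> carrier_mat n n"
    using assms by (rule pow_carrier_mat)
  then show ?case
    using assms by (auto simp: Suc mult_smult_assoc_mat[of _ n n _ n] mult_smult_distrib[of _ n n _ n] ac_simps)
qed

text \<open>Entry (i,j) of the k-th power of the Jordan block with eigenvalue a is binom(k, j-i)
  a^(k+i-j) on and above the diagonal. For a = 0 only k = j-i survives, so each exponential series
  has at most one nonzero term.\<close>

lemma mat_exp_jordan_block_0:
  "mat_exp (t \<cdot>\<^sub>m jordan_block n 0) = mat n n (\<lambda>(i, j). if i \<le> j then t ^ (j - i) / fact (j - i) else 0)"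
proof (intro eq_matI)
  fix i j assume "i < dim_row (mat n n (\<lambda>(i, j). if i \<le> j then t ^ (j - i) / fact (j - i) else 0))"
    "j < dim_col (mat n n (\<lambda>(i, j). if i \<le> j then t ^ (j - i) / fact (j - i) else 0))"
  then have ij: "i < n" "j < n" by auto
  have "((t \<cdot>\<^sub>m jordan_block n 0) ^\<^sub>m k) $$ (i, j) / fact k
      = (if k = j - i then if i \<le> j then t ^ (j - i) / fact (j - i) else 0 else 0)" for k
  proof -
    \<comment> \<open>For \<open>k < j - i\<close> the truncated exponent gives 0^0 = 1; there it is
      the binomial coefficient that vanishes.\<close>
    have "of_nat (k choose (j - i)) * (0::real) ^ (k + i - j) = (if k = j - i then 1 else 0)" if "i \<le> j"
      using that by (cases "k < j - i") (auto simp: binomial_eq_0)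
    then show ?thesis
      using ij by (auto simp: smult_pow_mat[of _ n] jordan_block_pow)
  qed
  then have "(\<Sum>k. ((t \<cdot>\<^sub>m jordan_block n 0) ^\<^sub>m k) $$ (i, j) / fact k)
      = (if i \<le> j then t ^ (j - i) / fact (j - i) else 0)"
    by (simp only: sums_unique[OF sums_single, symmetric])
  then show "mat_exp (t \<cdot>\<^sub>m jordan_block n 0) $$ (i, j)
      = mat n n (\<lambda>(i, j). if i \<le> j then t ^ (j - i) / fact (j - i) else 0) $$ (i, j)"
    using ij by (simp add: mat_exp_def)
qed (simp_all add: mat_exp_def)

text \<open>Row k, reindexed by the distance from the diagonal, becomes the Taylor sum that appears
  in \<open>integrator_chain_solution\<close>.\<close>

lemma mat_exp_jordan_block_0_mult_vec:
  assumes "v \<in> carrier_vec n" "k < n"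
  shows "(mat_exp (t \<cdot>\<^sub>m jordan_block n 0) *\<^sub>v v) $ k = (\<Sum>i\<le>n - 1 - k. t ^ i / fact i * v $ (k + i))"
proof -
  have "(mat_exp (t \<cdot>\<^sub>m jordan_block n 0) *\<^sub>v v) $ k
      = (\<Sum>l\<in>{0..<n}. if k \<le> l then t ^ (l - k) / fact (l - k) * v $ l else 0)"
    using assms by (auto simp: mat_exp_jordan_block_0 scalar_prod_def intro!: sum.cong)
  also have "\<dots> = (\<Sum>l\<in>{k..n - 1}. t ^ (l - k) / fact (l - k) * v $ l)"
    using assms by (intro sum.mono_neutral_cong_right) auto
  also have "\<dots> = (\<Sum>i\<le>n - 1 - k. t ^ i / fact i * v $ (k + i))"
    using assms by (intro sum.reindex_bij_witness[of _ "\<lambda>i. k + i" "\<lambda>l. l - k"]) auto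
  finally show ?thesis .
qed

section \<open>The support function\<close>

lemma brunovsky_A_carrier: "brunovsky_A m r \<in> carrier_mat (\<Sum>j<m. r j) (\<Sum>j<m. r j)"
  by (intro carrier_matI)
    (simp_all add: brunovsky_A_def dim_diag_block_mat interv_sum_list_conv_sum_set_nat atLeast0LessThan o_def)

lemma brunovsky_B_carrier: "brunovsky_B m r \<in> carrier_mat (\<Sum>j<m. r j) m"
  by (intro carrier_matI)
    (simp_all add: brunovsky_B_def dim_diag_block_mat interv_sum_list_conv_sum_set_nat atLeast0LessThan o_def
      sum_list_triv)

lemma brunovsky_dynamics:
  assumes v: "v \<in> carrier_vec (\<Sum>j<m. r j)" and w: "w \<in> carrier_vec m" and j: "j < m" and k: "k < r j"
  shows "(brunovsky_A m r *\<^sub>v v + brunovsky_B m r *\<^sub>v w) $ ((\<Sum>i<j. r i) + k)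
       = (if Suc k < r j then v $ ((\<Sum>i<j. r i) + Suc k) else w $ j)"
proof -
  let ?i = "(\<Sum>i<j. r i) + k"
  have "?i < (\<Sum>j<m. r j)"
    using j k by (rule block_index_less)
  then have "(brunovsky_A m r *\<^sub>v v + brunovsky_B m r *\<^sub>v w) $ ?i
      = (brunovsky_A m r *\<^sub>v v) $ ?i + (brunovsky_B m r *\<^sub>v w) $ ?i"
    using brunovsky_B_carrier[of m r] by simp
  also have "(brunovsky_A m r *\<^sub>v v) $ ?i = block r j (brunovsky_A m r *\<^sub>v v) $ k"
    using k by simp
  also have "block r j (brunovsky_A m r *\<^sub>v v) = jordan_block (r j) 0 *\<^sub>v block r j v"
    unfolding brunovsky_A_def using v j by (intro diag_block_mat_mult_vec) auto
  also have "\<dots> $ k = (if Suc k < r j then v $ ((\<Sum>i<j. r i) + Suc k) else 0)"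
    using k by (subst jordan_block_0_mult_vec) (auto simp: block_def)
  also have "(brunovsky_B m r *\<^sub>v w) $ ?i = block r j (brunovsky_B m r *\<^sub>v w) $ k"
    using k by simp
  \<comment> \<open>The input vector is read as \<open>m\<close> blocks of length one, whose j-th
    block is the single entry \<open>w $ j\<close>.\<close>
  also have "block r j (brunovsky_B m r *\<^sub>v w)
      = mat_of_cols (r j) [unit_vec (r j) (r j - 1)] *\<^sub>v block (\<lambda>_. 1) j w"
    unfolding brunovsky_B_def using w j by (intro diag_block_mat_mult_vec) auto
  also have "\<dots> $ k = (if Suc k < r j then 0 else w $ j)"
    using k by (subst unit_column_mult_vec) (auto simp: block_def)
  finally show ?thesis by simp
qed

text \<open>Regroup the scalar integral equations by blocks; \<open>brunovsky_dynamics\<close>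
  identifies each integrand with the next component of the chain or with its input.\<close>

lemma state_trajectory_brunovsky_iff:
  assumes u: "\<And>s. s \<in> {0..t} \<Longrightarrow> u s \<in> carrier_vec m"
  shows "state_trajectory (brunovsky_A m r) (brunovsky_B m r) t u x \<longleftrightarrow>
     (\<forall>s\<in>{0..t}. x s \<in> carrier_vec (\<Sum>j<m. r j)) \<and>
     (\<forall>j<m. integrator_chain (r j) t (\<lambda>s. u s $ j) (\<lambda>k s. x s $ ((\<Sum>i<j. r i) + k)))"
proof -
  let ?d = "\<Sum>j<m. r j"
  let ?I = "\<lambda>s i. has_bochner_integral (lebesgue_on {0..s})
      (\<lambda>\<tau>. (brunovsky_A m r *\<^sub>v x \<tau> + brunovsky_B m r *\<^sub>v u \<tau>) $ i) (x s $ i - x 0 $ i)"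
  have d: "dim_row (brunovsky_A m r) = ?d"
    using brunovsky_A_carrier[of m r] by simp
  have all_i: "(\<forall>i<?d. P i) \<longleftrightarrow> (\<forall>j<m. \<forall>k<r j. P ((\<Sum>i<j. r i) + k))" for P
  proof (intro iffI allI impI)
    fix i assume P: "\<forall>j<m. \<forall>k<r j. P ((\<Sum>i<j. r i) + k)" and "i < ?d"
    from this(2) obtain j k where "j < m" "k < r j" "i = (\<Sum>i<j. r i) + k"
      by (rule block_index_cases)
    with P show "P i" by blast
  qed (use block_index_less in blast)
  \<comment> \<open>The integrands are compared only at times in [0,t], where states and inputs have
    the dimensions needed to evaluate the matrix products.\<close>
  have I: "?I s ((\<Sum>i<j. r i) + k) \<longleftrightarrow>
      has_bochner_integral (lebesgue_on {0..s})
        (if Suc k < r j then \<lambda>s. x s $ ((\<Sum>i<j. r i) + Suc k) else (\<lambda>s. u s $ j))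
        (x s $ ((\<Sum>i<j. r i) + k) - x 0 $ ((\<Sum>i<j. r i) + k))"
    if "\<forall>s\<in>{0..t}. x s \<in> carrier_vec ?d" "s \<in> {0..t}" "j < m" "k < r j" for s j k
  proof (rule has_bochner_integral_cong)
    fix \<tau> assume "\<tau> \<in> space (lebesgue_on {0..s})"
    then have "\<tau> \<in> {0..t}" using that(2) by auto
    then show "(brunovsky_A m r *\<^sub>v x \<tau> + brunovsky_B m r *\<^sub>v u \<tau>) $ ((\<Sum>i<j. r i) + k)
      = (if Suc k < r j then \<lambda>s. x s $ ((\<Sum>i<j. r i) + Suc k) else (\<lambda>s. u s $ j)) \<tau>"
      using brunovsky_dynamics[of "x \<tau>" r m "u \<tau>" j k] that u by simp
  qed auto
  show ?thesis
    unfolding state_trajectory_def d all_i integrator_chain_def using I by blast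
qed

section \<open>Scalar products with the final state\<close>

text \<open>Variation of constants paired with \<open>y\<close>: \<open>xi n (t - s)\<close> is the
  response at time t to an impulse at time s. The box bounds make every component integrable, so the
  finite sum and the integral commute. \<open>q\<close> is the offset of the block and
  \<open>b\<close> extracts it.\<close>

lemma scalar_prod_integrator_chain:
  fixes u :: "real \<Rightarrow> real" and y :: "real vec"
  assumes chain: "integrator_chain n t u (\<lambda>k s. x s $ (q + k))" and "0 \<le> t"
    and u: "u \<in> borel_measurable (lebesgue_on {0..t})" "\<And>s. s \<in> {0..t} \<Longrightarrow> u s \<in> {\<alpha>..\<beta>}"
  defines "b \<equiv> \<lambda>v. vec n (\<lambda>k. v $ (q + k))"
  shows "y \<bullet> b (x t) = y \<bullet> (mat_exp (t \<cdot>\<^sub>m jordan_block n 0) *\<^sub>v b (x 0))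
           + (LINT s|lebesgue_on {0..t}. (y \<bullet> xi n (t - s)) * u s)"
proof -
  let ?L = "lebesgue_on {0..t}"
  define e where "e = mat_exp (t \<cdot>\<^sub>m jordan_block n 0) *\<^sub>v b (x 0)"
  have comp: "b (x t) $ k = e $ k + (LINT s|?L. xi n (t - s) $ k * u s)" if k: "k < n" for k
  proof -
    have "b (x t) $ k = (\<Sum>i\<le>n - 1 - k. t ^ i / fact i * x 0 $ (q + (k + i)))
        + (LINT s|?L. (t - s) ^ (n - 1 - k) / fact (n - 1 - k) * u s)"
      \<comment> \<open>Distance \<open>n - 1 - k\<close> from the end is component
        \<open>k\<close>.\<close>
      using integrator_chain_solution[OF chain, of "n - 1 - k" t] k \<open>0 \<le> t\<close> by (simp add: b_def)
    also have "(\<Sum>i\<le>n - 1 - k. t ^ i / fact i * x 0 $ (q + (k + i)))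
        = (\<Sum>i\<le>n - 1 - k. t ^ i / fact i * b (x 0) $ (k + i))"
      using k by (intro sum.cong) (auto simp: b_def)
    also have "\<dots> = e $ k"
      unfolding e_def using k by (subst mat_exp_jordan_block_0_mult_vec) (auto simp: b_def)
    finally show ?thesis using k by (simp add: xi_def)
  qed
  have int: "integrable ?L (\<lambda>s. xi n (t - s) $ k * u s)" if "k < n" for k
  proof (rule integrable_bounded_mult_continuous[OF _ u])
    show "continuous_on {0..t} (\<lambda>s. xi n (t - s) $ k)"
      using that by (auto simp: xi_def intro!: continuous_intros)
  qed
  have dim: "dim_vec e = n" "dim_vec (xi n s) = n" "dim_vec (b v) = n" for s v
    by (simp_all add: e_def mat_exp_def xi_def b_def)
  have "(LINT s|?L. (y \<bullet> xi n (t - s)) * u s)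
      = (LINT s|?L. (\<Sum>k\<in>{0..<n}. y $ k * (xi n (t - s) $ k * u s)))"
    by (simp add: scalar_prod_def dim sum_distrib_right mult.assoc)
  also have "\<dots> = (\<Sum>k\<in>{0..<n}. (LINT s|?L. y $ k * (xi n (t - s) $ k * u s)))"
    using int by (intro Bochner_Integration.integral_sum) auto
  also have "\<dots> = (\<Sum>k\<in>{0..<n}. y $ k * (LINT s|?L. xi n (t - s) $ k * u s))"
    by simp
  finally have "(LINT s|?L. (y \<bullet> xi n (t - s)) * u s)
      = (\<Sum>k\<in>{0..<n}. y $ k * (LINT s|?L. xi n (t - s) $ k * u s))" .
  then show ?thesis
    unfolding e_def[symmetric] by (simp add: scalar_prod_def dim comp distrib_left sum.distrib)
qed

lemma continuous_on_scalar_prod_xi: "continuous_on S (\<lambda>s. y \<bullet> xi n s)"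
  by (auto simp: scalar_prod_def xi_def intro!: continuous_intros)

lemma scalar_prod_zeta: "y \<bullet> zeta n t = integral {0..t} (\<lambda>s. y \<bullet> xi n s)"
proof -
  have int: "(\<lambda>s. xi n s $ k) integrable_on {0..t}" if "k < n" for k
    using that by (intro integrable_continuous_real) (auto simp: xi_def intro!: continuous_intros)
  have "integral {0..t} (\<lambda>s. y \<bullet> xi n s) = integral {0..t} (\<lambda>s. \<Sum>k\<in>{0..<n}. y $ k * xi n s $ k)"
    by (simp add: scalar_prod_def xi_def)
  also have "\<dots> = (\<Sum>k\<in>{0..<n}. y $ k * integral {0..t} (\<lambda>s. xi n s $ k))"
    by (subst Henstock_Kurzweil_Integration.integral_sum) (auto intro!: integrable_on_mult_right int)
  finally show ?thesis
    by (simp add: scalar_prod_def zeta_def)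
qed

theorem theorem1:
  fixes m d :: nat and r :: "nat \<Rightarrow> nat" and \<alpha> \<beta> \<mu> \<nu> :: "nat \<Rightarrow> real"
    and x0 y :: "real vec" and t :: real
  assumes "\<And>j. j < m \<Longrightarrow> 0 < r j"
    and "(\<Sum>j<m. r j) = d"
    and "\<And>j. j < m \<Longrightarrow> \<alpha> j \<le> \<beta> j"
    and "x0 \<in> carrier_vec d"
    and "0 \<le> t"
    and "y \<in> carrier_vec d"
    and "\<And>j. j < m \<Longrightarrow> \<mu> j = (\<beta> j - \<alpha> j) / 2"
    and "\<And>j. j < m \<Longrightarrow> \<nu> j = (\<beta> j + \<alpha> j) / 2"
  shows "support_function
           (reach_set (brunovsky_A m r) (brunovsky_B m r) (input_box m \<alpha> \<beta>) {x0} t) y =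
         (\<Sum>j<m. block r j y \<bullet>
                   (mat_exp (t \<cdot>\<^sub>m jordan_block (r j) 0) *\<^sub>v block r j x0 + \<nu> j \<cdot>\<^sub>v zeta (r j) t)
               + \<mu> j * integral {0..t} (\<lambda>s. \<bar>block r j y \<bullet> xi (r j) s\<bar>))"
    (is "support_function ?R y = (\<Sum>j<m. ?h j)")
proof -
  let ?A = "brunovsky_A m r" and ?B = "brunovsky_B m r" and ?U = "input_box m \<alpha> \<beta>"
  let ?L = "lebesgue_on {0..t}" and ?o = "\<lambda>j. \<Sum>i<j. r i"
  \<comment> \<open>Per block: \<open>E\<close> is the free response, \<phi> the weight of the input
    at time s in the scalar product, and \<open>V\<close> the largest contribution of the
    input.\<close>
  define E where "E j = mat_exp (t \<cdot>\<^sub>m jordan_block (r j) 0) *\<^sub>v block r j x0" for j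
  define \<phi> where "\<phi> j s = block r j y \<bullet> xi (r j) (t - s)" for j s
  define V where "V j = (\<beta> j + \<alpha> j) / 2 * integral {0..t} (\<phi> j)
      + (\<beta> j - \<alpha> j) / 2 * integral {0..t} (\<lambda>s. \<bar>\<phi> j s\<bar>)" for j
  have \<phi>_cont: "continuous_on {0..t} (\<phi> j)" for j
    unfolding \<phi>_def by (rule continuous_on_compose2[OF continuous_on_scalar_prod_xi[of UNIV]])
      (auto intro!: continuous_intros)
  have h: "?h j = block r j y \<bullet> E j + V j" if "j < m" for j
  proof -
    have "integral {0..t} (\<phi> j) = block r j y \<bullet> zeta (r j) t"
      unfolding \<phi>_def scalar_prod_zeta
      by (rule integral_reflect_about_midpoint[of t "\<lambda>s. block r j y \<bullet> xi (r j) s"])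
    moreover have "integral {0..t} (\<lambda>s. \<bar>\<phi> j s\<bar>) = integral {0..t} (\<lambda>s. \<bar>block r j y \<bullet> xi (r j) s\<bar>)"
      unfolding \<phi>_def
      by (rule integral_reflect_about_midpoint[of t "\<lambda>s. \<bar>block r j y \<bullet> xi (r j) s\<bar>"])
    moreover have "block r j y \<bullet> (E j + \<nu> j \<cdot>\<^sub>v zeta (r j) t)
        = block r j y \<bullet> E j + \<nu> j * (block r j y \<bullet> zeta (r j) t)"
    proof -
      have "block r j y \<in> carrier_vec (r j)" "E j \<in> carrier_vec (r j)" "zeta (r j) t \<in> carrier_vec (r j)"
        by (intro carrier_vecI, simp add: E_def mat_exp_def zeta_def)+
      then show ?thesis
        by (subst scalar_prod_add_distrib[of _ "r j"]) auto
    qed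
    ultimately show ?thesis
      by (simp only: E_def V_def assms(7,8)[OF that] add.assoc)
  qed
  \<comment> \<open>The inputs contribute separately, so each can be optimised on its own; the free
    response is the same for all of them.\<close>
  have payoff: "y \<bullet> x t = (\<Sum>j<m. block r j y \<bullet> E j + (LINT s|?L. \<phi> j s * u s $ j))"
    if u: "admissible_input m ?U t u" and x: "state_trajectory ?A ?B t u x" "x 0 = x0" for u x
  proof -
    have carr: "u s \<in> carrier_vec m" if "s \<in> {0..t}" for s
      using u that by (auto simp: admissible_input_def input_box_def)
    have traj: "\<forall>s\<in>{0..t}. x s \<in> carrier_vec (\<Sum>j<m. r j)"
        "\<forall>j<m. integrator_chain (r j) t (\<lambda>s. u s $ j) (\<lambda>k s. x s $ (?o j + k))"
      using x(1) state_trajectory_brunovsky_iff[of t u m r x] carr by blast+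
    have "y \<bullet> x t = (\<Sum>j<m. block r j y \<bullet> block r j (x t))"
      using traj \<open>0 \<le> t\<close> by (intro scalar_prod_blocks) auto
    also have "\<dots> = (\<Sum>j<m. block r j y \<bullet> E j + (LINT s|?L. \<phi> j s * u s $ j))"
    proof (intro sum.cong refl)
      fix j assume "j \<in> {..<m}"
      then have j: "j < m" by simp
      have "block r j y \<bullet> vec (r j) (\<lambda>k. x t $ (?o j + k))
          = block r j y \<bullet> (mat_exp (t \<cdot>\<^sub>m jordan_block (r j) 0) *\<^sub>v vec (r j) (\<lambda>k. x 0 $ (?o j + k)))
            + (LINT s|?L. (block r j y \<bullet> xi (r j) (t - s)) * u s $ j)"
      proof (rule scalar_prod_integrator_chain[where \<alpha> = "\<alpha> j" and \<beta> = "\<beta> j"])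
        show "integrator_chain (r j) t (\<lambda>s. u s $ j) (\<lambda>k s. x s $ (?o j + k))"
          using traj j by blast
        show "(\<lambda>s. u s $ j) \<in> borel_measurable ?L" "\<And>s. s \<in> {0..t} \<Longrightarrow> u s $ j \<in> {\<alpha> j..\<beta> j}"
          using u j unfolding admissible_input_def input_box_def by blast+
      qed fact
      then show "block r j y \<bullet> block r j (x t) = block r j y \<bullet> E j + (LINT s|?L. \<phi> j s * u s $ j)"
        by (simp add: E_def \<phi>_def block_def x(2))
    qed
    finally show ?thesis .
  qed
  have dimB: "dim_col ?B = m"
    using brunovsky_B_carrier[of m r] by simp
  have upper: "y \<bullet> z \<le> (\<Sum>j<m. ?h j)" if z: "z \<in> ?R" for z
  proof -
    obtain u x where ux: "admissible_input m ?U t u" "state_trajectory ?A ?B t u x" "x 0 = x0" "z = x t"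
      using z unfolding reach_set_def dimB by blast
    have "(LINT s|?L. \<phi> j s * u s $ j) \<le> V j" if "j < m" for j
      unfolding V_def using ux(1) that
      by (intro box_control_integral_le[OF \<phi>_cont]) (auto simp: admissible_input_def input_box_def)
    then show ?thesis
      unfolding ux(4) payoff[OF ux(1-3)] by (intro sum_mono) (simp add: h)
  qed
  have "\<exists>z \<in> ?R. y \<bullet> z = (\<Sum>j<m. ?h j)"
  proof -
    \<comment> \<open>The sign of \<phi> selects an endpoint of the interval; where \<phi> vanishes,
      \<open>sgn\<close> is 0 and the control is the midpoint, which is also admissible.\<close>
    define c where "c j s = (\<beta> j + \<alpha> j) / 2 + (\<beta> j - \<alpha> j) / 2 * sgn (\<phi> j s)" for j s
    define u where "u s = vec m (\<lambda>j. c j s)" for s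
    have c_meas: "c j \<in> borel_measurable ?L" for j
    proof -
      have "\<phi> j \<in> borel_measurable ?L"
        using continuous_imp_integrable_real[OF \<phi>_cont] by auto
      then show ?thesis unfolding c_def by measurable
    qed
    have c_box: "c j s \<in> {\<alpha> j..\<beta> j}" if "j < m" for j s
      using assms(3)[OF that] by (auto simp: c_def sgn_if field_simps)
    have u: "admissible_input m ?U t u"
      using c_meas c_box by (auto simp: admissible_input_def input_box_def u_def)
    have "\<exists>w. integrator_chain (r j) t (c j) w \<and> (\<forall>k<r j. w k 0 = x0 $ (?o j + k))" if "j < m" for j
    proof (rule integrator_chain_exists)
      show "integrable ?L (c j)"
        \<comment> \<open>The weight is taken to be the constant 1.\<close>
        using integrable_bounded_mult_continuous[of t "\<lambda>_. 1" "c j" "\<alpha> j" "\<beta> j"] c_meas c_box[OF that]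
        by simp
    qed
    then obtain w where w: "\<And>j. j < m \<Longrightarrow> integrator_chain (r j) t (c j) (w j)"
        "\<And>j k. j < m \<Longrightarrow> k < r j \<Longrightarrow> w j k 0 = x0 $ (?o j + k)"
      by metis
    \<comment> \<open>At each time the separately solved chains are stacked into one state vector;
      choice then yields the trajectory.\<close>
    have "\<forall>s. \<exists>x \<in> carrier_vec d. \<forall>j<m. block r j x = vec (r j) (\<lambda>k. w j k s)"
      using vec_of_blocks_exists[of r m "\<lambda>j k. w j k _"] assms(2) by simp
    then obtain x where x: "\<And>s. x s \<in> carrier_vec d"
        "\<And>s j. j < m \<Longrightarrow> block r j (x s) = vec (r j) (\<lambda>k. w j k s)"
      by metis
    have x_index: "x s $ (?o j + k) = w j k s" if "j < m" "k < r j" for j k s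
      using arg_cong[OF x(2)[OF that(1)], of "\<lambda>v. v $ k" s] that by simp
    have "integrator_chain (r j) t (\<lambda>s. u s $ j) (\<lambda>k s. x s $ (?o j + k))" if "j < m" for j
    proof -
      have "(\<lambda>s. u s $ j) = c j"
        using that by (simp add: u_def fun_eq_iff)
      moreover have "integrator_chain (r j) t (c j) (\<lambda>k s. x s $ (?o j + k))
          \<longleftrightarrow> integrator_chain (r j) t (c j) (w j)"
        using x_index[OF that] by (intro integrator_chain_cong) auto
      ultimately show ?thesis
        using w(1)[OF that] by simp
    qed
    then have traj: "state_trajectory ?A ?B t u x"
      using state_trajectory_brunovsky_iff[of t u m r x] x(1) unfolding assms(2) by (simp add: u_def)
    have x_init: "x 0 = x0"
    proof (rule eq_vec_blocksI)
      show "x 0 \<in> carrier_vec (\<Sum>j<m. r j)" "x0 \<in> carrier_vec (\<Sum>j<m. r j)"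
        unfolding assms(2) by fact+
      show "block r j (x 0) = block r j x0" if "j < m" for j
        unfolding x(2)[OF that] using w(2)[OF that] by (intro eq_vecI) auto
    qed
    have "x t \<in> ?R"
      unfolding reach_set_def dimB using u traj x_init by blast
    moreover have "(LINT s|?L. \<phi> j s * u s $ j) = V j" if "j < m" for j
      using bang_bang_integral_eq[OF \<phi>_cont[of j], of "\<beta> j" "\<alpha> j"] that by (simp add: V_def u_def c_def)
    then have "y \<bullet> x t = (\<Sum>j<m. ?h j)"
      unfolding payoff[OF u traj x_init] by (intro sum.cong) (simp_all add: h)
    ultimately show ?thesis by blast
  qed
  then obtain z where "z \<in> ?R" "y \<bullet> z = (\<Sum>j<m. ?h j)"
    by blast
  \<comment> \<open>The upper bound is itself a value on the reach set, so the supremum is a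
    maximum.\<close>
  then have "(\<Sum>j<m. ?h j) \<in> (\<lambda>z. y \<bullet> z) ` ?R"
    by (metis imageI)
  then show ?thesis
    unfolding support_function_def by (rule cSup_eq_maximum) (use upper in blast)
qed

end
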